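(* For all positive integers $n,m$ with $m$ even, the one-sided error randomized query complexity and the exact quantum query complexity of $g_{n,m}$ satisfy $R_1(g_{n,m})=\tilde O(n+m)$ and $Q_E(g_{n,m})=\tilde O(n+m)$.
   Context: Let $n,m$ be positive integers with $m$ even, $M=[n]\times[m]$ (a grid of cells with $n$ rows and $m$ columns), $\tilde M = M\cup\{\bot\}$ (pointers to cells, $\bot$ is the null pointer). Let $T$ be the following fixed binary tree with $m$ leaves and $m-1$ internal nodes: if $m=2^k$, $T$ is the complete binary tree with $2^k$ leaves; if $2^k<m<2^{k+1}$, take the complete binary tree with $2^k$ leaves and add a pair of children to each of its $m-2^k$ leftmost leaves. Outgoing arcs of internal nodes are labeled 'left' and 'right', leaves are labeled $1,\dots,m$ from left to right, and $T(j)$ is the sequence of 'left'/'right' labels on the root-to-leaf-$j$ path. The input alphabet is $\Sigma=\{0,1\}\times\tilde M\times\tilde M\times\tilde M$; for $v\in\Sigma$ its components are $\mathrm{val}(v),\mathrm{lpoint}(v),\mathrm{rpoint}(v),\mathrm{bpoint}(v)$. The function $g_{n,m}\colon\Sigma^M\to\{0,1\}$ is defined by $g_{n,m}(x)=1$ iff: (1) there is exactly one column $b\in[m]$ with $\mathrm{val}(x_{i,b})=1$ for all $i\in[n]$ (the marked column); (2) in column $b$ there is a unique cell $a$ with $x_a\ne(1,\bot,\bot,\bot)$ (the special element); (3) for each column $j\in[m]\setminus\{b\}$, the path starting at $a$ and following $\mathrm{lpoint},\mathrm{rpoint}$ as specified by $T(j)$ exists (no pointer on it is $\bot$) and ends in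 a cell $\ell_j$ in column $j$ with $\mathrm{val}(x_{\ell_j})=0$; (4') the set $G=\{j\in[m]\setminus\{b\} : \mathrm{bpoint}(x_{\ell_j})=a\}$ has size exactly $m/2$. A query asks for the value $x_c\in\Sigma$ of one cell. $R_1(f)$ is the minimum worst-case expected number of queries of a randomized decision tree that rejects every $x$ with $f(x)=0$ with probability $1$ and accepts every $x$ with $f(x)=1$ with probability at least $1/2$. $Q_E(f)$ is the minimum number of queries of a quantum query algorithm (queries $O_x|c,p\rangle|w\rangle=|c,p+x_c \bmod|\Sigma|\rangle|w\rangle$, identifying $\Sigma$ with $[|\Sigma|]$) that outputs $f(x)$ with probability $1$ on every input. $\tilde O$ hides factors polylogarithmic in $n,m$. *)

theory Defs
  imports "HOL-Analysis.Analysis" "HOL-Probability.Probability" "HOL-Library.FuncSet"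
begin

(* cells (i,j): row i < n, column j < m, 0-indexed *)
type_synonym cell = "nat \<times> nat"
(* val, lpoint, rpoint, bpoint; None is the null pointer *)
type_synonym sym = "bool \<times> cell option \<times> cell option \<times> cell option"

definition Mset :: "nat \<Rightarrow> nat \<Rightarrow> cell set" where
  "Mset n m = {0..<n} \<times> {0..<m}"

definition Ptrs :: "nat \<Rightarrow> nat \<Rightarrow> cell option set" where
  "Ptrs n m = insert None (Some ` Mset n m)"

definition Sigma_alph :: "nat \<Rightarrow> nat \<Rightarrow> sym set" where
  "Sigma_alph n m = UNIV \<times> Ptrs n m \<times> Ptrs n m \<times> Ptrs n m"

definition Inputs :: "nat \<Rightarrow> nat \<Rightarrow> (cell \<Rightarrow> sym) set" where
  "Inputs n m = Mset n m \<rightarrow>\<^sub>E Sigma_alph n m"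

definition sval :: "sym \<Rightarrow> bool" where "sval v = fst v"
definition lpoint :: "sym \<Rightarrow> cell option" where "lpoint v = fst (snd v)"
definition rpoint :: "sym \<Rightarrow> cell option" where "rpoint v = fst (snd (snd v))"
definition bpoint :: "sym \<Rightarrow> cell option" where "bpoint v = snd (snd (snd v))"

(* direction labels: False = left, True = right *)
(* binary expansion of t with k digits, most significant first, 0 = left *)
fun bin_digits :: "nat \<Rightarrow> nat \<Rightarrow> bool list" where
  "bin_digits 0 t = []"
| "bin_digits (Suc k) t = bin_digits k (t div 2) @ [odd t]"

definition tree_depth :: "nat \<Rightarrow> nat" where
  "tree_depth m = (GREATEST k. 2 ^ k \<le> m)"

(* T(j) for leaf j, with leaves numbered 0..m-1 from left to right
   (leaf number j+1 in the paper's 1-based numbering).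
   The complete tree with 2^k leaves has leaf t at path bin_digits k t;
   its r = m - 2^k leftmost leaves get two children each. *)
definition Tpath :: "nat \<Rightarrow> nat \<Rightarrow> bool list" where
  "Tpath m j = (let k = tree_depth m; r = m - 2 ^ k in
     if j < 2 * r then bin_digits k (j div 2) @ [odd j]
     else bin_digits k (j - r))"

fun follow :: "(cell \<Rightarrow> sym) \<Rightarrow> cell \<Rightarrow> bool list \<Rightarrow> cell option" where
  "follow x a [] = Some a"
| "follow x a (d # ds) =
     (case (if d then rpoint (x a) else lpoint (x a)) of
        None \<Rightarrow> None
      | Some c \<Rightarrow> follow x c ds)"

definition marked_col :: "nat \<Rightarrow> (cell \<Rightarrow> sym) \<Rightarrow> nat \<Rightarrow> bool" where
  "marked_col n x b \<longleftrightarrow> (\<forall>i<n. sval (x (i, b)))"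

definition g_fun :: "nat \<Rightarrow> nat \<Rightarrow> (cell \<Rightarrow> sym) \<Rightarrow> bool" where
  "g_fun n m x \<longleftrightarrow>
    (\<exists>b<m. marked_col n x b \<and> (\<forall>b'<m. marked_col n x b' \<longrightarrow> b' = b) \<and>
     (\<exists>a. a \<in> Mset n m \<and> snd a = b \<and> x a \<noteq> (True, None, None, None) \<and>
        (\<forall>a'. a' \<in> Mset n m \<and> snd a' = b \<and> x a' \<noteq> (True, None, None, None) \<longrightarrow> a' = a) \<and>
        (\<forall>j<m. j \<noteq> b \<longrightarrow>
           (\<exists>l. follow x a (Tpath m j) = Some l \<and> snd l = j \<and> \<not> sval (x l))) \<and>
        card {j. j < m \<and> j \<noteq> b \<and>
                 bpoint (x (the (follow x a (Tpath m j)))) = Some a} = m div 2))"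

datatype dtree = Leaf bool | Query cell "sym \<Rightarrow> dtree"

primrec dt_run :: "dtree \<Rightarrow> (cell \<Rightarrow> sym) \<Rightarrow> bool" where
  "dt_run (Leaf b) x = b"
| "dt_run (Query c f) x = dt_run (f (x c)) x"

primrec dt_cost :: "dtree \<Rightarrow> (cell \<Rightarrow> sym) \<Rightarrow> nat" where
  "dt_cost (Leaf b) x = 0"
| "dt_cost (Query c f) x = Suc (dt_cost (f (x c)) x)"

definition one_sided :: "(cell \<Rightarrow> sym) set \<Rightarrow> ((cell \<Rightarrow> sym) \<Rightarrow> bool) \<Rightarrow> dtree pmf \<Rightarrow> bool" where
  "one_sided X f D \<longleftrightarrow> (\<forall>x\<in>X.
     (\<not> f x \<longrightarrow> measure_pmf.prob D {t. dt_run t x} = 0) \<and>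
     (f x \<longrightarrow> measure_pmf.prob D {t. dt_run t x} \<ge> 1/2))"

definition worst_expected_cost :: "(cell \<Rightarrow> sym) set \<Rightarrow> dtree pmf \<Rightarrow> ennreal" where
  "worst_expected_cost X D = (SUP x\<in>X. \<integral>\<^sup>+ t. ennreal (real (dt_cost t x)) \<partial>measure_pmf D)"

definition R1 :: "(cell \<Rightarrow> sym) set \<Rightarrow> ((cell \<Rightarrow> sym) \<Rightarrow> bool) \<Rightarrow> ennreal" where
  "R1 X f = (INF D\<in>{D. one_sided X f D}. worst_expected_cost X D)"

definition ptr_enc :: "nat \<Rightarrow> cell option \<Rightarrow> nat" where
  "ptr_enc m p = (case p of None \<Rightarrow> 0 | Some (i, j) \<Rightarrow> 1 + i * m + j)"

definition Kp :: "nat \<Rightarrow> nat \<Rightarrow> nat" where "Kp n m = n * m + 1"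

definition Ssize :: "nat \<Rightarrow> nat \<Rightarrow> nat" where "Ssize n m = 2 * Kp n m ^ 3"

(* a bijection \<Sigma> \<rightarrow> [|\<Sigma>|] (0-based) *)
definition sym_enc :: "nat \<Rightarrow> nat \<Rightarrow> sym \<Rightarrow> nat" where
  "sym_enc n m v = (if sval v then 1 else 0) + 2 * (ptr_enc m (lpoint v)
      + Kp n m * (ptr_enc m (rpoint v) + Kp n m * ptr_enc m (bpoint v)))"

definition cell_of :: "nat \<Rightarrow> nat \<Rightarrow> cell" where "cell_of m c = (c div m, c mod m)"

(* Hilbert space C^(nm) \<otimes> C^|\<Sigma>| \<otimes> C^W, basis |c,p,w\<rangle> = index (c*|\<Sigma>| + p)*W + w *)
definition qdim :: "nat \<Rightarrow> nat \<Rightarrow> nat \<Rightarrow> nat" where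
  "qdim n m W = n * m * Ssize n m * W"

definition oracle_map :: "nat \<Rightarrow> nat \<Rightarrow> nat \<Rightarrow> (cell \<Rightarrow> sym) \<Rightarrow> nat \<Rightarrow> nat" where
  "oracle_map n m W x k =
     (let w = k mod W; q = k div W; p = q mod Ssize n m; c = q div Ssize n m in
      (c * Ssize n m + (p + sym_enc n m (x (cell_of m c))) mod Ssize n m) * W + w)"

type_synonym cmatrix = "nat \<Rightarrow> nat \<Rightarrow> complex"

definition oracle_mat :: "nat \<Rightarrow> nat \<Rightarrow> nat \<Rightarrow> (cell \<Rightarrow> sym) \<Rightarrow> cmatrix" where
  "oracle_mat n m W x i j = (if i = oracle_map n m W x j then 1 else 0)"

definition unitary_mat :: "nat \<Rightarrow> cmatrix \<Rightarrow> bool" where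
  "unitary_mat D U \<longleftrightarrow> (\<forall>i<D. \<forall>k<D. (\<Sum>j<D. U i j * cnj (U k j)) = (if i = k then 1 else 0))"

definition mat_vec :: "nat \<Rightarrow> cmatrix \<Rightarrow> (nat \<Rightarrow> complex) \<Rightarrow> (nat \<Rightarrow> complex)" where
  "mat_vec D U v = (\<lambda>i. \<Sum>j<D. U i j * v j)"

fun qrun :: "nat \<Rightarrow> cmatrix \<Rightarrow> cmatrix list \<Rightarrow> (nat \<Rightarrow> complex) \<Rightarrow> (nat \<Rightarrow> complex)" where
  "qrun D Ox [] v = v"
| "qrun D Ox [U] v = mat_vec D U v"
| "qrun D Ox (U # V # Us) v = qrun D Ox (V # Us) (mat_vec D Ox (mat_vec D U v))"

definition init_state :: "nat \<Rightarrow> complex" where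
  "init_state = (\<lambda>i. if i = 0 then 1 else 0)"

definition accept_prob :: "nat \<Rightarrow> nat \<Rightarrow> nat \<Rightarrow> cmatrix list \<Rightarrow> (nat \<Rightarrow> bool) \<Rightarrow> (cell \<Rightarrow> sym) \<Rightarrow> real" where
  "accept_prob n m W Us out x =
     (\<Sum>k\<in>{k. k < qdim n m W \<and> out k}.
        (cmod (qrun (qdim n m W) (oracle_mat n m W x) Us init_state k))\<^sup>2)"

definition exact_quantum :: "nat \<Rightarrow> nat \<Rightarrow> (cell \<Rightarrow> sym) set \<Rightarrow> ((cell \<Rightarrow> sym) \<Rightarrow> bool) \<Rightarrow> nat \<Rightarrow> bool" where
  "exact_quantum n m X f T \<longleftrightarrow>
     (\<exists>W Us out. W > 0 \<and> length Us = T + 1 \<and>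
        (\<forall>U\<in>set Us. unitary_mat (qdim n m W) U) \<and>
        (\<forall>x\<in>X. accept_prob n m W Us out x = (if f x then 1 else 0)))"

definition QE :: "nat \<Rightarrow> nat \<Rightarrow> (cell \<Rightarrow> sym) set \<Rightarrow> ((cell \<Rightarrow> sym) \<Rightarrow> bool) \<Rightarrow> nat" where
  "QE n m X f = Inf {T. exact_quantum n m X f T}"

end

theory Submission
  imports Defs
begin

text \<open>
  For a fixed column \<open>j\<close>, the conjunction of \<open>g_fun n m x\<close> and \<open>j \<in> G\<close> is decided by one
  deterministic tree with \<open>O((n + m) log m)\<close> queries. If it holds, some cell of column \<open>j\<close> points back
  to the special element, so reading column \<open>j\<close> leaves at most \<open>n\<close> candidates. Follow the path from a
  candidate \<open>a\<close> to a column \<open>j'\<close> other than its own: success exhibits a zero in \<open>j'\<close>, so \<open>j'\<close> is not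
  marked; failure discards \<open>a\<close>. After at most \<open>n + m\<close> such probes only the column of one candidate can
  be marked, and it is verified directly.

  If \<open>g_fun n m x\<close> holds, exactly half of the \<open>m\<close> columns accept; otherwise none does. A uniformly random
  column therefore gives the one-sided algorithm, and the Deutsch--Jozsa algorithm on the column
  index distinguishes the balanced predicate from the constant one with certainty.
\<close>

section \<open>Exact quantum simulation of a balanced family of strategies\<close>

text \<open>The complements of \<open>B\<close> and of its image in the finite set \<open>A\<close>
  have equally many elements, so any bijection between them completes \<open>f\<close>. This turns a
  transition rule given on some basis states into a permutation of all of them.\<close>

lemma inj_on_extends_to_bij:
  assumes "finite A" "B \<subseteq> A" "f ` B \<subseteq> A" "inj_on f B"
  shows "\<exists>p. bij_betw p A A \<and> (\<forall>x\<in>B. p x = f x)"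
proof -
  have fin: "finite B" using assms finite_subset by blast
  have "card (A - B) = card (A - f ` B)"
    using assms fin by (simp add: card_Diff_subset card_image)
  then obtain g where g: "bij_betw g (A - B) (A - f ` B)"
    using assms(1) finite_same_card_bij by (metis finite_Diff)
  let ?p = "\<lambda>x. if x \<in> B then f x else g x"
  have "bij_betw ?p B (f ` B)"
    using assms(4) by (auto simp: bij_betw_def inj_on_def)
  moreover have "bij_betw ?p (A - B) (A - f ` B)"
    using g by (subst bij_betw_cong[of _ _ g]) auto
  ultimately have "bij_betw ?p (B \<union> (A - B)) (f ` B \<union> (A - f ` B))"
    by (rule bij_betw_combine) auto
  moreover have "B \<union> (A - B) = A" "f ` B \<union> (A - f ` B) = A" using assms by auto
  ultimately show ?thesis by (intro exI[of _ ?p]) auto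
qed

section \<open>Signed permutation matrices acting on finite superpositions\<close>

definition mono_mat :: "(nat \<Rightarrow> real) \<Rightarrow> (nat \<Rightarrow> nat) \<Rightarrow> cmatrix" where
  "mono_mat \<phi> p i j = of_real (if i = p j then \<phi> j else 0)"

lemma oracle_mat_mono: "oracle_mat n m W x = mono_mat (\<lambda>_. 1) (oracle_map n m W x)"
  by (intro ext) (simp add: oracle_mat_def mono_mat_def)

lemma unitary_mono_mat:
  assumes p: "bij_betw p {..<D} {..<D}" and \<phi>: "\<And>j. \<phi> j * \<phi> j = 1"
  shows "unitary_mat D (mono_mat \<phi> p)"
  unfolding unitary_mat_def
proof (intro allI impI)
  fix i k assume ik: "i < D" "k < D"
  obtain a where a: "a < D" "p a = i"
    using p ik unfolding bij_betw_def by (metis imageE lessThan_iff)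
  have inj: "inj_on p {..<D}" using p by (simp add: bij_betw_def)
  have "(\<Sum>j<D. mono_mat \<phi> p i j * cnj (mono_mat \<phi> p k j)) =
      (\<Sum>j<D. if a = j then of_real (if k = i then 1 else 0) else 0)"
  proof (rule sum.cong[OF refl])
    fix j assume j: "j \<in> {..<D}"
    have "i = p j \<longleftrightarrow> a = j" using inj a j by (auto simp: inj_on_def)
    then show "mono_mat \<phi> p i j * cnj (mono_mat \<phi> p k j) =
      (if a = j then of_real (if k = i then 1 else 0) else 0)"
      using a \<phi>[of j] by (auto simp: mono_mat_def simp flip: of_real_mult)
  qed
  then show "(\<Sum>j<D. mono_mat \<phi> p i j * cnj (mono_mat \<phi> p k j)) = (if i = k then 1 else 0)"
    using a by auto
qed

text \<open>The vector with amplitude \<open>\<alpha> j\<close> on basis state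
  \<open>\<pi> j\<close>; amplitudes landing on the same index add up, so linear maps can be applied
  branch by branch.\<close>

definition superpos :: "nat \<Rightarrow> (nat \<Rightarrow> real) \<Rightarrow> (nat \<Rightarrow> nat) \<Rightarrow> nat \<Rightarrow> real" where
  "superpos m \<alpha> \<pi> i = (\<Sum>j<m. if i = \<pi> j then \<alpha> j else 0)"

lemma superpos_cong:
  assumes "\<And>j. j < m \<Longrightarrow> \<alpha> j = \<beta> j" "\<And>j. j < m \<Longrightarrow> \<pi> j = \<rho> j"
  shows "superpos m \<alpha> \<pi> = superpos m \<beta> \<rho>"
  using assms by (auto simp: superpos_def fun_eq_iff intro!: sum.cong)

lemma sum_mult_superpos:
  assumes "\<And>j. j < m \<Longrightarrow> \<pi> j < D"
  shows "(\<Sum>i<D. w i * superpos m \<alpha> \<pi> i) = (\<Sum>j<m. w (\<pi> j) * \<alpha> j)"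
proof -
  have "(\<Sum>i<D. w i * superpos m \<alpha> \<pi> i) = (\<Sum>i<D. \<Sum>j<m. if i = \<pi> j then w i * \<alpha> j else 0)"
    by (simp add: superpos_def sum_distrib_left if_distrib cong: if_cong)
  also have "\<dots> = (\<Sum>j<m. \<Sum>i<D. if i = \<pi> j then w i * \<alpha> j else 0)"
    by (rule sum.swap)
  also have "\<dots> = (\<Sum>j<m. w (\<pi> j) * \<alpha> j)"
    using assms by (intro sum.cong) auto
  finally show ?thesis .
qed

lemma superpos_at:
  assumes "inj_on \<pi> {..<m}" "j < m"
  shows "superpos m \<alpha> \<pi> (\<pi> j) = \<alpha> j"
proof -
  have "superpos m \<alpha> \<pi> (\<pi> j) = (\<Sum>j'<m. if j' = j then \<alpha> j' else 0)"
    unfolding superpos_def using assms by (intro sum.cong) (auto simp: inj_on_def)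
  then show ?thesis using assms by simp
qed

lemma mat_vec_of_real:
  "mat_vec D (\<lambda>i j. of_real (A i j)) (\<lambda>i. of_real (v i)) = (\<lambda>i. of_real (\<Sum>j<D. A i j * v j))"
  by (simp add: mat_vec_def)

lemma mat_vec_mono_mat:
  assumes "\<And>j. j < m \<Longrightarrow> \<pi> j < D"
  shows "mat_vec D (mono_mat \<phi> p) (\<lambda>i. of_real (superpos m \<alpha> \<pi> i)) =
    (\<lambda>i. of_real (superpos m (\<lambda>j. \<phi> (\<pi> j) * \<alpha> j) (\<lambda>j. p (\<pi> j)) i))"
proof -
  have "mat_vec D (mono_mat \<phi> p) (\<lambda>i. of_real (superpos m \<alpha> \<pi> i)) =
     (\<lambda>i. of_real (\<Sum>j<D. (if i = p j then \<phi> j else 0) * superpos m \<alpha> \<pi> j))"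
    unfolding mat_vec_of_real[symmetric] by (simp add: mono_mat_def[abs_def])
  also have "\<dots> = (\<lambda>i. of_real (\<Sum>j<m. (if i = p (\<pi> j) then \<phi> (\<pi> j) else 0) * \<alpha> j))"
    by (subst sum_mult_superpos[OF assms]) auto
  also have "\<dots> = (\<lambda>i. of_real (superpos m (\<lambda>j. \<phi> (\<pi> j) * \<alpha> j) (\<lambda>j. p (\<pi> j)) i))"
    by (intro ext) (auto simp: superpos_def intro!: sum.cong)
  finally show ?thesis .
qed

section \<open>Preparing and undoing the uniform superposition\<close>

text \<open>The Householder reflection exchanging the first basis vector and the unit vector \<open>s\<close>;
  it requires \<open>s 0 \<noteq> 1\<close>.\<close>

definition reflection :: "(nat \<Rightarrow> real) \<Rightarrow> nat \<Rightarrow> nat \<Rightarrow> real" where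
  "reflection s i j = of_bool (i = j) - (of_bool (i = 0) - s i) * (of_bool (j = 0) - s j) / (1 - s 0)"

lemma reflection_commute: "reflection s i j = reflection s j i"
  by (auto simp: reflection_def)

lemma reflection_0: "s 0 \<noteq> 1 \<Longrightarrow> reflection s i 0 = s i"
  by (auto simp: reflection_def)

text \<open>With \<open>t\<close> the difference of the first basis vector and \<open>s\<close>, the
  squared norm of \<open>t\<close> is \<open>2 * (1 - s 0)\<close>, so the matrix is
  \<open>I - 2 t t^T / |t|^2\<close>.\<close>

lemma reflection_orthogonal:
  assumes s: "(\<Sum>i<D. s i * s i) = 1" "s 0 \<noteq> 1" and D: "0 < D" and ik: "i < D" "k < D"
  shows "(\<Sum>j<D. reflection s i j * reflection s k j) = of_bool (i = k)"
proof -
  define t where "t = (\<lambda>i. of_bool (i = 0) - s i)"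
  define c where "c = 1 - s 0"
  have c: "c \<noteq> 0" using s by (simp add: c_def)
  have "(\<Sum>j<D. t j * t j) = (\<Sum>j<D. (if j = 0 then 1 - 2 * s j else 0) + s j * s j)"
    by (intro sum.cong) (auto simp: t_def algebra_simps)
  also have "\<dots> = 2 * c" using D s by (simp add: sum.distrib c_def)
  finally have tt: "(\<Sum>j<D. t j * t j) = 2 * c" .
  \<comment> \<open>Replacing the division by a factor \<open>d\<close> with
    \<open>c * d = 1\<close> makes the final cancellation a polynomial identity.\<close>
  define d where "d = 1 / c"
  have cd: "c * d = 1" using c by (simp add: d_def)
  have R: "reflection s a j = of_bool (a = j) - t a * t j * d" for a j
    by (simp add: reflection_def t_def c_def d_def)
  have "reflection s i j * reflection s k j = (if j = i then of_bool (i = k) - t k * t j * d else 0)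
        - (if j = k then t i * t j * d else 0) + (t i * t k * d * d) * (t j * t j)" for j
    unfolding R by (cases "i = j"; cases "k = j") (simp_all add: algebra_simps)
  then have "(\<Sum>j<D. reflection s i j * reflection s k j) =
     (\<Sum>j<D. (if j = i then of_bool (i = k) - t k * t j * d else 0)
        - (if j = k then t i * t j * d else 0) + (t i * t k * d * d) * (t j * t j))"
    by (simp only:)
  also have "\<dots> = (\<Sum>j<D. if j = i then of_bool (i = k) - t k * t j * d else 0)
      - (\<Sum>j<D. if j = k then t i * t j * d else 0) + (t i * t k * d * d) * (\<Sum>j<D. t j * t j)"
    by (simp only: sum.distrib sum_subtractf sum_distrib_left)
  also have "\<dots> = of_bool (i = k) - t k * t i * d - t i * t k * d + (t i * t k * d * d) * (2 * c)"
    unfolding tt using ik by (simp only: sum.delta finite_lessThan lessThan_iff if_True)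
  also have "\<dots> = of_bool (i = k)"
    using cd by algebra
  finally show ?thesis .
qed

text \<open>Expanding the squares and summing over \<open>k\<close> first leaves the Gram matrix of
  the rows, which is the identity; symmetry of the reflection exchanges rows and columns.\<close>

lemma reflection_norm:
  assumes s: "(\<Sum>i<D. s i * s i) = 1" "s 0 \<noteq> 1" and D: "0 < D"
  shows "(\<Sum>k<D. (\<Sum>j<D. reflection s k j * v j)\<^sup>2) = (\<Sum>j<D. v j * v j)"
proof -
  have "(\<Sum>k<D. (\<Sum>j<D. reflection s k j * v j)\<^sup>2) =
    (\<Sum>k<D. \<Sum>i<D. \<Sum>j<D. v i * v j * (reflection s i k * reflection s j k))"
    unfolding power2_eq_square sum_product
    by (intro sum.cong refl) (simp add: reflection_commute[of s] algebra_simps)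
  also have "\<dots> = (\<Sum>i<D. \<Sum>k<D. \<Sum>j<D. v i * v j * (reflection s i k * reflection s j k))"
    by (rule sum.swap)
  also have "\<dots> = (\<Sum>i<D. \<Sum>j<D. \<Sum>k<D. v i * v j * (reflection s i k * reflection s j k))"
    by (intro sum.cong refl sum.swap)
  also have "\<dots> = (\<Sum>i<D. \<Sum>j<D. v i * v j * of_bool (i = j))"
    by (intro sum.cong refl) (simp add: reflection_orthogonal[OF s D] flip: sum_distrib_left)
  also have "\<dots> = (\<Sum>i<D. \<Sum>j<D. if i = j then v i * v j else 0)"
    by (intro sum.cong) auto
  also have "\<dots> = (\<Sum>j<D. v j * v j)" by simp
  finally show ?thesis .
qed

section \<open>Circuit runs, register arithmetic and histories of adaptive queries\<close>

lemma qrun_Cons: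
  "Us \<noteq> [] \<Longrightarrow> qrun D Ox (U # Us) v = qrun D Ox Us (mat_vec D Ox (mat_vec D U v))"
  by (cases Us) auto

lemma qrun_replicate:
  assumes "Us \<noteq> []"
  shows "qrun D Ox (replicate k U @ Us) v = qrun D Ox Us (((\<lambda>v. mat_vec D Ox (mat_vec D U v)) ^^ k) v)"
  using assms by (induction k arbitrary: v) (auto simp: qrun_Cons funpow_Suc_right simp del: funpow.simps(2))

lemma oracle_map_eq:
  assumes "w < W" "p < Ssize n m"
  shows "oracle_map n m W x ((c * Ssize n m + p) * W + w) =
    (c * Ssize n m + (p + sym_enc n m (x (cell_of m c))) mod Ssize n m) * W + w"
  using assms by (simp add: oracle_map_def Let_def)

lemma mixed_radix_less:
  fixes a b p S :: nat
  assumes "a < b" "p < S"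
  shows "a * S + p < b * S"
proof -
  have "a * S + p < Suc a * S" using assms by simp
  also have "\<dots> \<le> b * S" using assms by (intro mult_le_mono) auto
  finally show ?thesis .
qed

text \<open>Here \<open>q\<close> merges a strategy with a fixed input: it sends the answers so far,
  oldest first, to the next answer.\<close>

primrec history :: "(nat list \<Rightarrow> nat) \<Rightarrow> nat \<Rightarrow> nat list" where
  "history q 0 = []"
| "history q (Suc k) = history q k @ [q (history q k)]"

lemma length_history [simp]: "length (history q k) = k"
  by (induction k) auto

lemma set_history: "(\<And>h. q h < S) \<Longrightarrow> set (history q k) \<subseteq> {..<S}"
  by (induction k) auto

lemma inj_neg_mod:
  assumes "a < S" "b < S" "(S - a) mod S = (S - b) mod (S::nat)"
  shows "a = b"
  using assms by (cases "a = 0"; cases "b = 0") auto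

text \<open>Deutsch--Jozsa over the branch index. A basis state \<open>(j, h, p)\<close> carries the branch, the answers
  collected so far and the contents of the answer register; the cell register always holds the
  next cell to be queried. Uncomputation presets the answer register to \<open>- p\<close>, so that the
  same oracle clears it.\<close>

lemma exact_quantum_balanced:
  fixes nx :: "nat \<Rightarrow> nat list \<Rightarrow> nat" and out :: "nat \<Rightarrow> nat list \<Rightarrow> bool"
  assumes m: "2 \<le> m" "even m"
    and nx: "\<And>j h. nx j h < n * m"
    and enc: "\<And>x c. x \<in> X \<Longrightarrow> c < n * m \<Longrightarrow> sym_enc n m (x (cell_of m c)) < Ssize n m"
    and balanced: "\<And>x. x \<in> X \<Longrightarrow>
      card {j. j < m \<and> out j (history (\<lambda>h. sym_enc n m (x (cell_of m (nx j h)))) (Suc d))} =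
        (if f x then m div 2 else 0)"
  shows "exact_quantum n m X f (2 * Suc d)"
proof -
  define S where "S = Ssize n m"
  have S0: "0 < S" by (simp add: S_def Ssize_def Kp_def)
  \<comment> \<open>Only \<open>d\<close> answers are stored although \<open>Suc d\<close> queries
    are made: the last answer stays in the answer register.\<close>
  define A where "A = {(j, h). j < m \<and> set h \<subseteq> {..<S} \<and> length h \<le> d}"
  have "A \<subseteq> {..<m} \<times> {h. set h \<subseteq> {..<S} \<and> length h \<le> d}"
    by (auto simp: A_def)
  then have finA: "finite A"
    by (rule finite_subset) (intro finite_cartesian_product finite_lists_length_le; simp)
  define W where "W = card A"
  obtain e where e: "bij_betw e A {0..<W}"
    using ex_bij_betw_finite_nat[OF finA] by (auto simp: W_def)
  have "(0, []) \<in> A" using m by (auto simp: A_def)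
  then have W0: "0 < W" using finA by (auto simp: W_def card_gt_0_iff)
  define D where "D = qdim n m W"
  define st where "st = (\<lambda>(j, h, p). (nx j h * S + p) * W + e (j, h))"
  define B where "B = {(j, h, p). (j, h) \<in> A \<and> p < S}"
  have eW: "e a < W" if "a \<in> A" for a
    using e that by (auto simp: bij_betw_def)
  \<comment> \<open>The work register recovers \<open>(j, h)\<close>, which already fixes the cell
    register, and then \<open>p\<close> can be read off.\<close>
  have st_inj: "inj_on st B"
  proof (rule inj_onI)
    fix b b' assume b: "b \<in> B" "b' \<in> B" and eq: "st b = st b'"
    obtain j h p j' h' p' where bs: "b = (j, h, p)" "b' = (j', h', p')" by (metis prod_cases3)
    have A: "(j, h) \<in> A" "(j', h') \<in> A" "p < S" "p' < S" using b bs by (auto simp: B_def)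
    have "st b mod W = e (j, h)" "st b' mod W = e (j', h')" using A eW by (auto simp: st_def bs)
    then have jh: "(j, h) = (j', h')" using eq e A by (metis bij_betw_def inj_onD)
    have "st b div W = nx j h * S + p" "st b' div W = nx j' h' * S + p'"
      using eW[OF A(1)] eW[OF A(2)] W0 by (simp_all add: st_def bs)
    then have "p = p'" using eq jh by simp
    then show "b = b'" using jh bs by simp
  qed
  have st_less: "st b < D" if "b \<in> B" for b
  proof -
    obtain j h p where b: "b = (j, h, p)" by (metis prod_cases3)
    have A: "(j, h) \<in> A" "p < S" using that b by (auto simp: B_def)
    have "nx j h * S + p < (n * m) * S"
      using nx A(2) by (rule mixed_radix_less)
    then have "(nx j h * S + p) * W + e (j, h) < (n * m) * S * W"
      using eW[OF A(1)] by (rule mixed_radix_less)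
    then show ?thesis by (simp add: b st_def D_def qdim_def S_def)
  qed
  have D0: "0 < D" using st_less[of "(0, [], 0)"] \<open>(0, []) \<in> A\<close> S0 by (auto simp: B_def)
  \<comment> \<open>Each circuit step is prescribed on legal states only; the extension is arbitrary
    on the other basis states, which carry no amplitude in the run.\<close>
  have ext: "\<exists>p. bij_betw p {..<D} {..<D} \<and> (\<forall>b\<in>B'. p (st b) = st (g b))"
    if B': "B' \<subseteq> B" and g: "inj_on g B'" "g ` B' \<subseteq> B" for B' g
  proof -
    let ?f = "\<lambda>i. st (g (inv_into B st i))"
    have inv: "inv_into B st (st b) = b" if "b \<in> B'" for b
      using that B' st_inj by (auto intro: inv_into_f_f)
    have "inj_on (st \<circ> g \<circ> inv_into B st) (st ` B')"
    proof (intro comp_inj_on)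
      have "inv_into B st ` st ` B' = B'" using inv by force
      then show "inj_on g (inv_into B st ` st ` B')"
        "inj_on st (g ` inv_into B st ` st ` B')"
        using g inj_on_subset[OF st_inj] by auto
      show "inj_on (inv_into B st) (st ` B')"
        using B' by (intro inj_on_inv_into) auto
    qed
    then have "inj_on ?f (st ` B')" by (simp add: comp_def)
    moreover have "?f ` st ` B' \<subseteq> {..<D}"
    proof (rule image_subsetI)
      fix i assume "i \<in> st ` B'"
      then obtain b where b: "b \<in> B'" "i = st b" by blast
      then have "g b \<in> B" using g(2) by blast
      then show "?f i \<in> {..<D}" using b inv st_less by simp
    qed
    moreover have "st ` B' \<subseteq> {..<D}" using B' st_less by auto
    ultimately have "\<exists>p. bij_betw p {..<D} {..<D} \<and> (\<forall>i\<in>st ` B'. p i = ?f i)"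
      by (intro inj_on_extends_to_bij) auto
    then show ?thesis using inv by auto
  qed
  \<comment> \<open>\<open>pU\<close> moves the answer into the record and empties the register,
    which also switches the cell register to the next query. The bound on \<open>length h\<close>
    keeps the record in \<open>A\<close>.\<close>
  obtain pU where pU: "bij_betw pU {..<D} {..<D}"
    "\<And>j h p. (j, h, p) \<in> B \<Longrightarrow> length h < d \<Longrightarrow> pU (st (j, h, p)) = st (j, h @ [p], 0)"
  proof -
    have "\<exists>p. bij_betw p {..<D} {..<D} \<and> (\<forall>b\<in>{(j, h, p). (j, h, p) \<in> B \<and> length h < d}.
        p (st b) = st ((\<lambda>(j, h, p). (j, h @ [p], 0)) b))"
      by (rule ext) (auto simp: B_def A_def inj_on_def S0)
    then show ?thesis using that by fastforce
  qed
  \<comment> \<open>\<open>pV\<close> works backwards: it takes the newest answer off the record and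
    presets the register to its negative.\<close>
  obtain pV where pV: "bij_betw pV {..<D} {..<D}"
    "\<And>j h p. (j, h @ [p], 0) \<in> B \<Longrightarrow> pV (st (j, h @ [p], 0)) = st (j, h, (S - p) mod S)"
  proof -
    have last: "last h < S" if "set h \<subseteq> {..<S}" "h \<noteq> []" for h
      using last_in_set[OF that(2)] that(1) by blast
    \<comment> \<open>A nonempty \<open>h\<close> is determined by \<open>butlast h\<close> and the
      residue of \<open>- last h\<close>.\<close>
    have inj: "inj_on (\<lambda>(j, h, p). (j, butlast h, (S - last h) mod S))
      {(j, h, p). (j, h, p) \<in> B \<and> h \<noteq> [] \<and> p = 0}"
    proof -
      have "h = h'" if h: "(j, h, 0) \<in> B" "(j', h', 0) \<in> B" "h \<noteq> []" "h' \<noteq> []"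
        "butlast h = butlast h'" "(S - last h) mod S = (S - last h') mod S" for j j' h h'
      proof -
        have "set h \<subseteq> {..<S}" "set h' \<subseteq> {..<S}" using h(1,2) by (simp_all add: B_def A_def)
        then have "last h < S" "last h' < S" using last h(3,4) by simp_all
        then have "last h = last h'" using h(6) by (rule inj_neg_mod)
        then show ?thesis using h(3-5) by (metis append_butlast_last_id)
      qed
      then show ?thesis by (fastforce simp: inj_on_def)
    qed
    have "\<exists>p. bij_betw p {..<D} {..<D} \<and>
        (\<forall>b\<in>{(j, h, p). (j, h, p) \<in> B \<and> h \<noteq> [] \<and> p = 0}.
        p (st b) = st ((\<lambda>(j, h, p). (j, butlast h, (S - last h) mod S)) b))"
      by (rule ext[OF _ inj]) (auto simp: B_def A_def S0 dest!: in_set_butlastD)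
    then obtain p where "bij_betw p {..<D} {..<D}"
      and p: "\<forall>b\<in>{(j, h, p). (j, h, p) \<in> B \<and> h \<noteq> [] \<and> p = 0}.
        p (st b) = st ((\<lambda>(j, h, p). (j, butlast h, (S - last h) mod S)) b)" by blast
    moreover have "p (st (j, h @ [r], 0)) = st (j, h, (S - r) mod S)" if "(j, h @ [r], 0) \<in> B" for j h r
      using p[rule_format, of "(j, h @ [r], 0)"] that by auto
    ultimately show ?thesis using that by blast
  qed
  \<comment> \<open>\<open>pQ\<close> negates the register in place, since the last answer was never
    recorded; this starts the uncomputation.\<close>
  obtain pQ where pQ: "bij_betw pQ {..<D} {..<D}"
    "\<And>j h p. (j, h, p) \<in> B \<Longrightarrow> pQ (st (j, h, p)) = st (j, h, (S - p) mod S)"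
  proof -
    have "\<exists>p. bij_betw p {..<D} {..<D} \<and> (\<forall>b\<in>B.
        p (st b) = st ((\<lambda>(j, h, p). (j, h, (S - p) mod S)) b))"
      by (rule ext) (auto simp: B_def A_def inj_on_def S0 intro: inj_neg_mod)
    then show ?thesis using that by fastforce
  qed
  \<comment> \<open>In \<open>mono_mat\<close> the sign belongs to the source state, so it is
    computed from the answer \<open>p\<close> before \<open>pQ\<close> negates it.\<close>
  define \<phi> :: "nat \<Rightarrow> real" where
    "\<phi> i = (if i \<in> st ` {(j, h, p). (j, h, p) \<in> B \<and> out j (h @ [p])} then - 1 else 1)" for i
  have \<phi>_st: "\<phi> (st (j, h, p)) = (if out j (h @ [p]) then - 1 else 1)" if "(j, h, p) \<in> B" for j h p
    using that inj_on_image_mem_iff[OF st_inj that, of "{(j, h, p). (j, h, p) \<in> B \<and> out j (h @ [p])}"]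
    by (auto simp: \<phi>_def)
  define base where "base j = st (j, [], 0)" for j
  have base_B: "(j, [], 0) \<in> B" if "j < m" for j
    using that S0 by (auto simp: B_def A_def)
  have base_inj: "inj_on base {..<m}"
    using st_inj base_B by (auto simp: inj_on_def base_def)
  have base_less: "base j < D" if "j < m" for j
    using base_B[OF that] st_less by (simp add: base_def)
  define r where "r = 1 / sqrt (real m)"
  have r2: "r * r = 1 / real m" by (simp add: r_def)
  define s where "s = superpos m (\<lambda>_. r) base"
  have s1: "(\<Sum>i<D. s i * s i) = 1"
  proof -
    have "(\<Sum>i<D. s i * s i) = (\<Sum>j<m. s (base j) * r)"
      using sum_mult_superpos[of m base D s "\<lambda>_. r"] base_less by (simp add: s_def)
    also have "\<dots> = (\<Sum>j<m. r * r)"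
      using base_inj by (intro sum.cong) (auto simp: s_def superpos_at)
    also have "\<dots> = 1" using m by (simp add: r2)
    finally show ?thesis .
  qed
  \<comment> \<open>The reflection divides by \<open>1 - s 0\<close>. The entry \<open>s 0\<close>
    is either 0 or \<open>r\<close>, and \<open>r\<close> differs from 1 because \<open>m\<close> is
    at least 2.\<close>
  have s0: "s 0 \<noteq> 1"
  proof
    assume 1: "s 0 = 1"
    have "\<exists>j<m. base j = 0"
    proof (rule ccontr)
      assume "\<not> ?thesis"
      then have "s 0 = 0" unfolding s_def superpos_def by (intro sum.neutral) force
      then show False using 1 by simp
    qed
    then obtain j where "j < m" "base j = 0" by blast
    then have "s 0 = r" using superpos_at[OF base_inj, of j] by (simp add: s_def)
    then have "1 / real m = 1" using 1 r2 by simp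
    then show False using m by simp
  qed
  define F :: cmatrix where "F = (\<lambda>i j. of_real (reflection s i j))"
  have F: "unitary_mat D F"
    unfolding unitary_mat_def
    using reflection_orthogonal[OF s1 s0 D0] 
    by (auto simp: F_def simp flip: of_real_mult of_real_sum)
  \<comment> \<open>An oracle call sits between any two consecutive matrices: the calls after
    \<open>F\<close> and after each \<open>pU\<close> compute the \<open>Suc d\<close> answers,
    those after \<open>pQ\<close> and after each \<open>pV\<close> clear them.\<close>
  define Us where "Us = [F] @ replicate d (mono_mat (\<lambda>_. 1) pU) @ [mono_mat \<phi> pQ]
     @ replicate d (mono_mat (\<lambda>_. 1) pV) @ [F]"
  \<comment> \<open>The last reflection returns the uniform superposition to index 0, so rejection
    is read off there and every other index accepts.\<close>
  define out' where "out' k \<longleftrightarrow> k \<noteq> 0" for k :: nat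
  have unitary: "\<forall>U\<in>set Us. unitary_mat D U"
    using F pU pV pQ by (auto simp: Us_def \<phi>_def intro!: unitary_mono_mat)
  have acc: "accept_prob n m W Us out' x = (if f x then 1 else 0)" if x: "x \<in> X" for x
  proof -
    define q where "q j h = sym_enc n m (x (cell_of m (nx j h)))" for j h
    have q: "q j h < S" for j h using enc[OF x nx] by (simp add: q_def S_def)
    define O' where "O' = oracle_mat n m W x"
    define state where "state \<alpha> b = (\<lambda>i. complex_of_real (superpos m \<alpha> (\<lambda>j. st (b j)) i))"
      for \<alpha> and b :: "nat \<Rightarrow> nat \<times> nat list \<times> nat"
    have step: "mat_vec D (mono_mat \<psi> p) (state \<alpha> b) = state \<beta> b'"
      if "\<And>j. j < m \<Longrightarrow> b j \<in> B" "\<And>j. j < m \<Longrightarrow> p (st (b j)) = st (b' j)"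
        "\<And>j. j < m \<Longrightarrow> \<psi> (st (b j)) * \<alpha> j = \<beta> j" for \<psi> p \<alpha> \<beta> b b'
    proof -
      have "mat_vec D (mono_mat \<psi> p) (state \<alpha> b) =
          (\<lambda>i. of_real (superpos m (\<lambda>j. \<psi> (st (b j)) * \<alpha> j) (\<lambda>j. p (st (b j))) i))"
        unfolding state_def using that(1) st_less by (intro mat_vec_mono_mat) blast
      also have "superpos m (\<lambda>j. \<psi> (st (b j)) * \<alpha> j) (\<lambda>j. p (st (b j))) =
          superpos m \<beta> (\<lambda>j. st (b' j))"
        using that by (intro superpos_cong)
      finally show ?thesis by (simp only: state_def)
    qed
    have orc: "oracle_map n m W x (st (j, h, p)) = st (j, h, (p + q j h) mod S)"
      if "(j, h, p) \<in> B" for j h p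
      using that eW by (auto simp: st_def B_def q_def S_def oracle_map_eq)
    let ?H = "\<lambda>j. history (q j)"
    have H: "(j, ?H j k, p) \<in> B" if "j < m" "k \<le> d" "p < S" for j k p
      using that set_history[of "q j" S k] q by (auto simp: B_def A_def)
    have neg: "((S - a) mod S + a) mod S = 0" if "a < S" for a
      using that by (simp add: mod_add_left_eq)
    let ?sg = "\<lambda>j. (if out j (?H j (Suc d)) then - 1 else 1) * r"
    have 1: "mat_vec D O' (state \<alpha> (\<lambda>j. (j, ?H j k, 0))) = state \<alpha> (\<lambda>j. (j, ?H j k, q j (?H j k)))"
      if "k \<le> d" for k \<alpha>
      unfolding O'_def oracle_mat_mono using that q
      by (intro step) (auto simp: orc H S0)
    have 2: "mat_vec D O' (state \<alpha> (\<lambda>j. (j, ?H j k, (S - q j (?H j k)) mod S))) =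
        state \<alpha> (\<lambda>j. (j, ?H j k, 0))"
      if "k \<le> d" for k \<alpha>
      unfolding O'_def oracle_mat_mono using that q
      by (intro step) (auto simp: orc H S0 neg)
    have U: "((\<lambda>v. mat_vec D O' (mat_vec D (mono_mat (\<lambda>_. 1) pU) v)) ^^ k)
        (state \<alpha> (\<lambda>j. (j, ?H j 0, q j (?H j 0)))) = state \<alpha> (\<lambda>j. (j, ?H j k, q j (?H j k)))"
      if "k \<le> d" for k \<alpha>
      using that
    proof (induction k)
      case (Suc k)
      have "mat_vec D (mono_mat (\<lambda>_. 1) pU) (state \<alpha> (\<lambda>j. (j, ?H j k, q j (?H j k)))) =
         state \<alpha> (\<lambda>j. (j, ?H j (Suc k), 0))"
        using Suc.prems q by (intro step) (auto simp: pU H)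
      then show ?case using Suc 1[of "Suc k" \<alpha>] by simp
    qed simp
    have V: "((\<lambda>v. mat_vec D O' (mat_vec D (mono_mat (\<lambda>_. 1) pV) v)) ^^ k)
        (state \<alpha> (\<lambda>j. (j, ?H j k, 0))) = state \<alpha> (\<lambda>j. (j, [], 0))"
      if "k \<le> d" for k \<alpha>
      using that
    proof (induction k)
      case (Suc k)
      have "mat_vec D (mono_mat (\<lambda>_. 1) pV) (state \<alpha> (\<lambda>j. (j, ?H j (Suc k), 0))) =
         state \<alpha> (\<lambda>j. (j, ?H j k, (S - q j (?H j k)) mod S))"
      proof (rule step)
        show "(j, ?H j (Suc k), 0) \<in> B" if "j < m" for j
          using H[of j "Suc k" 0] that Suc.prems S0 by blast
        then show "pV (st (j, ?H j (Suc k), 0)) = st (j, ?H j k, (S - q j (?H j k)) mod S)"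
          if "j < m" for j
          using that by (simp add: pV)
      qed simp
      then show ?case using Suc 2[of k \<alpha>] by (simp add: funpow_Suc_right del: funpow.simps history.simps)
    qed simp
    have Q: "mat_vec D (mono_mat \<phi> pQ) (state (\<lambda>_. r) (\<lambda>j. (j, ?H j d, q j (?H j d)))) =
       state ?sg (\<lambda>j. (j, ?H j d, (S - q j (?H j d)) mod S))"
      using q by (intro step) (auto simp: pQ H \<phi>_st)
    have "mat_vec D F init_state = (\<lambda>i. F i 0)"
      using D0 by (auto simp: mat_vec_def init_state_def if_distrib cong: if_cong)
    also have "\<dots> = state (\<lambda>_. r) (\<lambda>j. (j, ?H j 0, 0))"
      unfolding F_def reflection_0[of s, OF s0] by (simp add: state_def s_def base_def[abs_def])
    finally have I: "mat_vec D F init_state = state (\<lambda>_. r) (\<lambda>j. (j, ?H j 0, 0))" .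
    have "qrun D O' Us init_state = mat_vec D F (state ?sg (\<lambda>j. (j, [], 0)))"
      unfolding Us_def
      by (simp add: qrun_Cons qrun_replicate I 1[of 0, simplified] U[of d, simplified] Q 2 V
          del: history.simps(2))
    also have "state ?sg (\<lambda>j. (j, [], 0)) = (\<lambda>i. of_real (superpos m ?sg base i))"
      by (simp add: state_def base_def[abs_def])
    finally have run: "qrun D O' Us init_state =
       (\<lambda>i. of_real (\<Sum>j<D. reflection s i j * superpos m ?sg base j))"
      by (simp only: F_def mat_vec_of_real)
    define z where "z i = (\<Sum>j<D. reflection s i j * superpos m ?sg base j)" for i
    have acc_eq: "accept_prob n m W Us out' x = (\<Sum>k\<in>{..<D} - {0}. (z k)\<^sup>2)"
      unfolding accept_prob_def D_def[symmetric] O'_def[symmetric] run z_def[symmetric]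
      by (intro sum.cong) (auto simp: out'_def)
    \<comment> \<open>The total probability is 1 because the reflection preserves the norm, so
      acceptance is the mass missing from index 0.\<close>
    have "accept_prob n m W Us out' x = (\<Sum>k<D. (z k)\<^sup>2) - (z 0)\<^sup>2"
      unfolding acc_eq using D0 by (simp add: sum_diff1)
    also have "(\<Sum>k<D. (z k)\<^sup>2) = (\<Sum>j<D. superpos m ?sg base j * superpos m ?sg base j)"
      unfolding z_def by (rule reflection_norm[OF s1 s0 D0])
    also have "\<dots> = (\<Sum>j<m. superpos m ?sg base (base j) * ?sg j)"
      using base_less by (rule sum_mult_superpos)
    also have "\<dots> = (\<Sum>j<m. r * r)"
      using base_inj by (intro sum.cong) (auto simp: superpos_at)
    also have "\<dots> = 1" using m by (simp add: r2)
    finally have a: "accept_prob n m W Us out' x = 1 - (z 0)\<^sup>2" .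
    \<comment> \<open>The amplitude at 0 is the overlap with the uniform state, that is, the mean of
      the signs: 0 when half of the branches accept, 1 when none does.\<close>
    have "z 0 = (\<Sum>j<D. s j * superpos m ?sg base j)"
      unfolding z_def by (simp add: reflection_commute[of s 0] reflection_0[of s, OF s0])
    also have "\<dots> = (\<Sum>j<m. s (base j) * ?sg j)"
      using base_less by (rule sum_mult_superpos)
    also have "\<dots> = (\<Sum>j<m. (1 - 2 * of_bool (out j (?H j (Suc d)))) / real m)"
      using base_inj by (intro sum.cong refl) (auto simp: s_def superpos_at r2)
    also have "\<dots> = (real m - 2 * real (card {j. j < m \<and> out j (?H j (Suc d))})) / real m"
    proof -
      have "{..<m} \<inter> {j. out j (?H j (Suc d))} = {j. j < m \<and> out j (?H j (Suc d))}" by auto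
      then show ?thesis
        by (simp add: sum_subtractf sum.If_cases flip: sum_divide_distrib sum_distrib_left
            del: history.simps)
    qed
    also have "\<dots> = (if f x then 0 else 1)"
    proof -
      have "card {j. j < m \<and> out j (?H j (Suc d))} = (if f x then m div 2 else 0)"
        using balanced[OF x] by (simp add: q_def[abs_def] del: history.simps)
      moreover have "2 * real (m div 2) = real m" using m by (simp add: real_of_nat_div)
      ultimately show ?thesis using m by auto
    qed
    finally show ?thesis using a by simp
  qed
  have "length Us = 2 * Suc d + 1" by (simp add: Us_def)
  then show ?thesis
    unfolding exact_quantum_def using unitary acc W0 D_def by blast
qed

section \<open>Running a decision tree from encoded answers\<close>

lemma mixed_radix_inject:
  fixes a b p q S :: nat
  assumes "p < S" "q < S" "a * S + p = b * S + q"
  shows "a = b \<and> p = q"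
proof -
  have "(a * S + p) div S = a" "(b * S + q) div S = b" using assms(1,2) by simp_all
  then show ?thesis using assms(3) by simp
qed

lemma ptr_enc_less: "p \<in> Ptrs n m \<Longrightarrow> ptr_enc m p < Kp n m"
  using mixed_radix_less by (auto simp: Ptrs_def Mset_def ptr_enc_def Kp_def)

lemma inj_on_ptr_enc: "inj_on (ptr_enc m) (Ptrs n m)"
  by (rule inj_onI) (auto simp: Ptrs_def Mset_def ptr_enc_def dest: mixed_radix_inject[rotated 2])

text \<open>In Horner form the bound and the injectivity follow digit by digit from the mixed-radix
  lemmas.\<close>

lemma sym_enc_alt:
  "sym_enc n m v = ((ptr_enc m (bpoint v) * Kp n m + ptr_enc m (rpoint v)) * Kp n m
     + ptr_enc m (lpoint v)) * 2 + of_bool (sval v)"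
  by (simp add: sym_enc_def algebra_simps)

lemma sym_enc_less:
  assumes "v \<in> Sigma_alph n m"
  shows "sym_enc n m v < Ssize n m"
proof -
  have "sym_enc n m v < (Kp n m * Kp n m * Kp n m) * 2"
    unfolding sym_enc_alt using assms
    by (intro mixed_radix_less ptr_enc_less) (auto simp: Sigma_alph_def lpoint_def rpoint_def bpoint_def)
  then show ?thesis by (simp add: Ssize_def power3_eq_cube)
qed

lemma inj_on_sym_enc: "inj_on (sym_enc n m) (Sigma_alph n m)"
proof (rule inj_onI)
  fix v w assume v: "v \<in> Sigma_alph n m" and w: "w \<in> Sigma_alph n m" and eq: "sym_enc n m v = sym_enc n m w"
  have P: "lpoint v \<in> Ptrs n m" "rpoint v \<in> Ptrs n m" "bpoint v \<in> Ptrs n m"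
    "lpoint w \<in> Ptrs n m" "rpoint w \<in> Ptrs n m" "bpoint w \<in> Ptrs n m"
    using v w by (auto simp: Sigma_alph_def lpoint_def rpoint_def bpoint_def)
  note less = P[THEN ptr_enc_less]
  have b: "of_bool b < (2 :: nat)" for b by simp
  \<comment> \<open>The digits are peeled off from the least significant one: the value bit, then
    the left pointer, then the right and back pointers together.\<close>
  note 1 = mixed_radix_inject[OF b b eq[unfolded sym_enc_alt]]
  note 2 = mixed_radix_inject[OF less(1) less(4) conjunct1[OF 1]]
  note 3 = mixed_radix_inject[OF less(2) less(5) conjunct1[OF 2]]
  have "sval v = sval w" using 1 by (auto simp: of_bool_eq_iff)
  moreover have "lpoint v = lpoint w" using 2 P inj_on_ptr_enc by (metis inj_onD)
  moreover have "rpoint v = rpoint w" using 3 P inj_on_ptr_enc by (metis inj_onD)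
  moreover have "bpoint v = bpoint w" using 3 P inj_on_ptr_enc by (metis inj_onD)
  ultimately show "v = w"
    by (simp add: prod_eq_iff sval_def lpoint_def rpoint_def bpoint_def)
qed

definition sym_dec :: "nat \<Rightarrow> nat \<Rightarrow> nat \<Rightarrow> sym" where
  "sym_dec n m = inv_into (Sigma_alph n m) (sym_enc n m)"

lemma sym_dec_enc: "v \<in> Sigma_alph n m \<Longrightarrow> sym_dec n m (sym_enc n m v) = v"
  by (simp add: sym_dec_def inj_on_sym_enc)

section \<open>Decision trees as query strategies\<close>

text \<open>Inputs take the value \<open>undefined\<close> outside the grid, so a query there is answered without the oracle.
  After a leaf is reached, the remaining queries go to an arbitrary cell.\<close>

primrec next_query :: "nat \<Rightarrow> nat \<Rightarrow> dtree \<Rightarrow> nat list \<Rightarrow> cell" where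
  "next_query n m (Leaf b) h = (0, 0)"
| "next_query n m (Query c f) h = (if c \<in> Mset n m
    then case h of [] \<Rightarrow> c | v # h' \<Rightarrow> next_query n m (f (sym_dec n m v)) h'
    else next_query n m (f undefined) h)"

primrec verdict :: "nat \<Rightarrow> nat \<Rightarrow> dtree \<Rightarrow> nat list \<Rightarrow> bool" where
  "verdict n m (Leaf b) h = b"
| "verdict n m (Query c f) h = (if c \<in> Mset n m
    then case h of [] \<Rightarrow> False | v # h' \<Rightarrow> verdict n m (f (sym_dec n m v)) h'
    else verdict n m (f undefined) h)"

lemma next_query_in_Mset:
  assumes "0 < n" "0 < m"
  shows "next_query n m t h \<in> Mset n m"
proof (induction t arbitrary: h)
  case (Query c f)
  then show ?case by (auto split: list.split)
qed (use assms in \<open>simp add: Mset_def\<close>)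

text \<open>\<open>history\<close> grows at its end, while a decision tree consumes the oldest
  answer first; the shifted strategy is the one seen by the subtree after the first answer.\<close>

lemma history_Suc_shift: "history q (Suc k) = q [] # history (\<lambda>h. q (q [] # h)) k"
  by (induction k) auto

text \<open>A history at least as long as the cost reaches a leaf, so the default
  \<open>False\<close> of \<open>verdict\<close> does not occur, and surplus answers are ignored
  there.\<close>

lemma verdict_history:
  assumes x: "x \<in> Inputs n m" and "dt_cost t x \<le> d"
  shows "verdict n m t (history (\<lambda>h. sym_enc n m (x (next_query n m t h))) d) = dt_run t x"
  using assms(2)
proof (induction t arbitrary: d)
  case (Query c f)
  show ?case
  proof (cases "c \<in> Mset n m")
    case True
    obtain d' where d: "d = Suc d'" using Query.prems by (cases d) auto
    have "x c \<in> Sigma_alph n m" using x True by (auto simp: Inputs_def PiE_iff)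
    then show ?thesis
      using True Query.IH[of "f (x c)" d'] Query.prems
      by (simp add: d history_Suc_shift sym_dec_enc del: history.simps)
  next
    case False
    then have "x c = undefined" using x PiE_arb unfolding Inputs_def by metis
    then show ?thesis
      using False Query.IH[of "f undefined" d] Query.prems by simp
  qed
qed simp

section \<open>The decision tree for one column\<close>

text \<open>Subroutines are in continuation-passing style, as \<open>dtree\<close> has no
  sequencing: \<open>q\<close> hands its result \<open>v\<close> to a continuation \<open>k\<close>,
  and \<open>c\<close> bounds the queries made before that.\<close>

definition computes :: "(cell \<Rightarrow> sym) \<Rightarrow> (('b \<Rightarrow> dtree) \<Rightarrow> dtree) \<Rightarrow> 'b \<Rightarrow> nat \<Rightarrow> bool" where
  "computes x q v c \<longleftrightarrow> (\<forall>k. dt_run (q k) x = dt_run (k v) x \<and> dt_cost (q k) x \<le> c + dt_cost (k v) x)"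

lemma computes_run: "computes x q v c \<Longrightarrow> dt_run (q k) x = dt_run (k v) x"
  and computes_cost: "computes x q v c \<Longrightarrow> dt_cost (q k) x \<le> c + dt_cost (k v) x"
  by (auto simp: computes_def)

lemma computes_Query: "computes x (Query u) (x u) 1"
  by (simp add: computes_def)

primrec query_all :: "('a \<Rightarrow> ('b \<Rightarrow> dtree) \<Rightarrow> dtree) \<Rightarrow> 'a list \<Rightarrow> ('b list \<Rightarrow> dtree) \<Rightarrow> dtree" where
  "query_all q [] k = k []"
| "query_all q (y # ys) k = q y (\<lambda>v. query_all q ys (\<lambda>vs. k (v # vs)))"

lemma computes_query_all:
  "(\<And>y. y \<in> set ys \<Longrightarrow> computes x (q y) (F y) c) \<Longrightarrow>
    computes x (query_all q ys) (map F ys) (length ys * c)"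
proof (induction ys)
  case (Cons y ys)
  have y: "computes x (q y) (F y) c" and ys: "computes x (query_all q ys) (map F ys) (length ys * c)"
    using Cons by auto
  show ?case
    unfolding computes_def
  proof (intro allI conjI)
    fix k
    let ?k = "\<lambda>v. query_all q ys (\<lambda>vs. k (v # vs))"
    show "dt_run (query_all q (y # ys) k) x = dt_run (k (map F (y # ys))) x"
      using computes_run[OF y, of ?k] computes_run[OF ys, of "\<lambda>vs. k (F y # vs)"] by simp
    show "dt_cost (query_all q (y # ys) k) x \<le> length (y # ys) * c + dt_cost (k (map F (y # ys))) x"
      using computes_cost[OF y, of ?k] computes_cost[OF ys, of "\<lambda>vs. k (F y # vs)"] by simp
  qed
qed (simp add: computes_def)

fun probe :: "bool list \<Rightarrow> cell \<Rightarrow> ((cell \<times> sym) option \<Rightarrow> dtree) \<Rightarrow> dtree" where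
  "probe [] a k = Query a (\<lambda>v. k (Some (a, v)))"
| "probe (d # ds) a k = Query a (\<lambda>v. case (if d then rpoint v else lpoint v) of
     None \<Rightarrow> k None | Some c \<Rightarrow> probe ds c k)"

text \<open>One query per arc reads a pointer and one more reads the endpoint, whose contents are
  returned with it; a null pointer only stops earlier.\<close>

lemma computes_probe:
  assumes "length ds \<le> L"
  shows "computes x (probe ds a) (map_option (\<lambda>l. (l, x l)) (follow x a ds)) (Suc L)"
proof -
  have "dt_run (probe ds a k) x = dt_run (k (map_option (\<lambda>l. (l, x l)) (follow x a ds))) x \<and>
      dt_cost (probe ds a k) x \<le> Suc (length ds) + dt_cost (k (map_option (\<lambda>l. (l, x l)) (follow x a ds))) x"
    for k
    by (induction ds a k rule: probe.induct) (auto split: option.split)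
  then show ?thesis
    using assms unfolding computes_def by (meson add_le_mono1 dual_order.trans Suc_le_mono)
qed

text \<open>The row bound makes \<open>l\<close> a cell whose zero refutes
  \<open>marked_col\<close>, whatever candidate the probe started from.\<close>

definition is_leaf :: "nat \<Rightarrow> nat \<Rightarrow> (cell \<times> sym) option \<Rightarrow> bool" where
  "is_leaf n j r \<longleftrightarrow> (\<exists>l v. r = Some (l, v) \<and> fst l < n \<and> snd l = j \<and> \<not> sval v)"

definition blank :: sym where "blank = (True, None, None, None)"

section \<open>Certified columns and their number\<close>

text \<open>\<open>certifies n m x j a\<close>: \<open>g_fun n m x\<close> holds with special element \<open>a\<close>, and \<open>j\<close> lies in the set \<open>G\<close> of (4').\<close>

definition certifies :: "nat \<Rightarrow> nat \<Rightarrow> (cell \<Rightarrow> sym) \<Rightarrow> nat \<Rightarrow> cell \<Rightarrow> bool" where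
  "certifies n m x j a \<longleftrightarrow> a \<in> Mset n m \<and> marked_col n x (snd a) \<and> x a \<noteq> blank \<and>
     (\<forall>a'\<in>Mset n m. snd a' = snd a \<and> x a' \<noteq> blank \<longrightarrow> a' = a) \<and>
     (\<forall>j'<m. j' \<noteq> snd a \<longrightarrow>
        (\<exists>l. follow x a (Tpath m j') = Some l \<and> snd l = j' \<and> \<not> sval (x l))) \<and>
     card {j'. j' < m \<and> j' \<noteq> snd a \<and>
        bpoint (x (the (follow x a (Tpath m j')))) = Some a} = m div 2 \<and>
     j \<noteq> snd a \<and> bpoint (x (the (follow x a (Tpath m j)))) = Some a"

lemma pointers_in_Ptrs:
  assumes "x \<in> Inputs n m" "a \<in> Mset n m"
  shows "lpoint (x a) \<in> Ptrs n m" "rpoint (x a) \<in> Ptrs n m" "bpoint (x a) \<in> Ptrs n m"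
proof -
  have "x a \<in> Sigma_alph n m" using assms by (auto simp: Inputs_def PiE_iff)
  then show "lpoint (x a) \<in> Ptrs n m" "rpoint (x a) \<in> Ptrs n m" "bpoint (x a) \<in> Ptrs n m"
    by (auto simp: Sigma_alph_def lpoint_def rpoint_def bpoint_def)
qed

lemma follow_in_Mset:
  assumes x: "x \<in> Inputs n m"
  shows "a \<in> Mset n m \<Longrightarrow> follow x a ds = Some l \<Longrightarrow> l \<in> Mset n m"
proof (induction ds arbitrary: a)
  case (Cons d ds)
  then obtain c where c: "(if d then rpoint (x a) else lpoint (x a)) = Some c" "follow x c ds = Some l"
    by (auto split: option.splits)
  moreover have "Some c \<in> Ptrs n m"
    using pointers_in_Ptrs[OF x Cons.prems(1)] by (metis c(1))
  ultimately show ?case using Cons.IH by (auto simp: Ptrs_def)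
qed simp

lemma certifies_leaf:
  assumes "x \<in> Inputs n m" "certifies n m x j a" "j' < m" "j' \<noteq> snd a"
  shows "\<exists>l. follow x a (Tpath m j') = Some l \<and> fst l < n \<and> snd l = j' \<and> \<not> sval (x l)"
proof -
  have a: "a \<in> Mset n m" and "\<exists>l. follow x a (Tpath m j') = Some l \<and> snd l = j' \<and> \<not> sval (x l)"
    using assms(2-4) unfolding certifies_def by blast+
  then obtain l where l: "follow x a (Tpath m j') = Some l" "snd l = j'" "\<not> sval (x l)" by blast
  have "fst l < n" using follow_in_Mset[OF assms(1) a l(1)] by (auto simp: Mset_def)
  then show ?thesis using l by blast
qed

text \<open>Uniqueness of the marked column is not part of \<open>certifies\<close>; it follows
  because every other column contains the zero at the end of its path.\<close>

lemma certifies_imp_g_fun: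
  assumes x: "x \<in> Inputs n m" and a: "certifies n m x j a"
  shows "g_fun n m x"
proof -
  have "b = snd a" if b: "b < m" "marked_col n x b" for b
  proof (rule ccontr)
    assume "b \<noteq> snd a"
    then obtain l where "fst l < n" "snd l = b" "\<not> sval (x l)"
      using certifies_leaf[OF x a b(1)] by blast
    then show False using b(2) by (metis marked_col_def prod.collapse)
  qed
  moreover have "snd a < m" using a by (auto simp: certifies_def Mset_def)
  ultimately show ?thesis
    using a unfolding certifies_def blank_def g_fun_def by (intro exI[of _ "snd a"] conjI exI[of _ a]) blast+
qed

text \<open>If \<open>g_fun\<close> holds, a certified cell can only be the special element, since
  its column is marked; the certified columns then form exactly \<open>G\<close>.\<close>

lemma card_certified:
  assumes x: "x \<in> Inputs n m"
  shows "card {j. j < m \<and> (\<exists>a. certifies n m x j a)} = (if g_fun n m x then m div 2 else 0)"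
proof (cases "g_fun n m x")
  case True
  obtain b a where b: "b < m" "marked_col n x b" "\<forall>b'<m. marked_col n x b' \<longrightarrow> b' = b"
    and a: "a \<in> Mset n m" "snd a = b" "x a \<noteq> blank"
      "\<forall>a'. a' \<in> Mset n m \<and> snd a' = b \<and> x a' \<noteq> blank \<longrightarrow> a' = a"
    and leaf: "\<forall>j<m. j \<noteq> b \<longrightarrow> (\<exists>l. follow x a (Tpath m j) = Some l \<and> snd l = j \<and> \<not> sval (x l))"
    and G: "card {j. j < m \<and> j \<noteq> b \<and> bpoint (x (the (follow x a (Tpath m j)))) = Some a} = m div 2"
    using True unfolding g_fun_def blank_def[symmetric] by (elim exE conjE) (rule that)
  have "a' = a" if "certifies n m x j a'" for a' j
  proof -
    have a': "a' \<in> Mset n m" "marked_col n x (snd a')" "x a' \<noteq> blank"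
      using that by (simp_all add: certifies_def)
    then have "snd a' < m" by (auto simp: Mset_def)
    then show ?thesis using a' a(4) b(3) by blast
  qed
  moreover
  have "certifies n m x j a \<longleftrightarrow>
      j \<noteq> b \<and> bpoint (x (the (follow x a (Tpath m j)))) = Some a" for j
    using a b leaf G unfolding certifies_def by blast
  ultimately have "{j. j < m \<and> (\<exists>a. certifies n m x j a)} =
      {j. j < m \<and> j \<noteq> b \<and> bpoint (x (the (follow x a (Tpath m j)))) = Some a}"
    by (intro Collect_cong) metis
  then show ?thesis using G True by simp
next
  case False
  then show ?thesis using certifies_imp_g_fun[OF x] by auto
qed

section \<open>Direct verification of one column\<close>

definition verify_special :: "nat \<Rightarrow> nat \<Rightarrow> nat \<Rightarrow> cell \<Rightarrow> dtree" where
  "verify_special n m j a = query_all (\<lambda>j'. probe (Tpath m j') a) [0..<m] (\<lambda>rs.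
     Leaf ((\<forall>j'<m. j' \<noteq> snd a \<longrightarrow> is_leaf n j' (rs ! j')) \<and>
       card {j'. j' < m \<and> j' \<noteq> snd a \<and> bpoint (snd (the (rs ! j'))) = Some a} = m div 2 \<and>
       j \<noteq> snd a \<and> bpoint (snd (the (rs ! j))) = Some a))"

definition verify_column :: "nat \<Rightarrow> nat \<Rightarrow> nat \<Rightarrow> nat \<Rightarrow> sym list \<Rightarrow> dtree" where
  "verify_column n m j b vs =
    (if b < m \<and> (\<forall>i<n. sval (vs ! i)) \<and> (\<exists>!i. i < n \<and> vs ! i \<noteq> blank)
     then verify_special n m j (THE i. i < n \<and> vs ! i \<noteq> blank, b) else Leaf False)"

text \<open>The argument is a column and not a candidate: several candidates may share the surviving
  column, and reading it determines which cell can be special.\<close>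

definition verify :: "nat \<Rightarrow> nat \<Rightarrow> nat \<Rightarrow> nat \<Rightarrow> dtree" where
  "verify n m j b = query_all Query (map (\<lambda>i. (i, b)) [0..<n]) (verify_column n m j b)"

lemma verify_run_cost:
  assumes x: "x \<in> Inputs n m" and j: "j < m" and L: "\<And>j. j < m \<Longrightarrow> length (Tpath m j) \<le> L"
  shows "dt_run (verify n m j b) x \<longleftrightarrow> (\<exists>a. snd a = b \<and> certifies n m x j a)"
    and "dt_cost (verify n m j b) x \<le> n + m * Suc L"
proof -
  let ?vs = "map x (map (\<lambda>i. (i, b)) [0..<n])"
  let ?c = "b < m \<and> (\<forall>i<n. sval (?vs ! i)) \<and> (\<exists>!i. i < n \<and> ?vs ! i \<noteq> blank)"
  define a where "a = (THE i. i < n \<and> ?vs ! i \<noteq> blank, b)"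
  define r where "r j' = map_option (\<lambda>l. (l, x l)) (follow x a (Tpath m j'))" for j'
  let ?rs = "map r [0..<m]"
  let ?t = "verify_special n m j a"
  have sa: "snd a = b" by (simp add: a_def)
  have col: "computes x (query_all Query (map (\<lambda>i. (i, b)) [0..<n])) ?vs (length (map (\<lambda>i. (i, b)) [0..<n]) * 1)"
    by (intro computes_query_all computes_Query)
  \<comment> \<open>All \<open>m\<close> columns are probed, that of \<open>a\<close> included, so
    position \<open>j'\<close> of \<open>?rs\<close> belongs to column \<open>j'\<close>.\<close>
  have paths: "computes x (query_all (\<lambda>j'. probe (Tpath m j') a) [0..<m]) ?rs (length [0..<m] * Suc L)"
    unfolding r_def by (intro computes_query_all computes_probe L) simp
  have col_eq: "verify_column n m j b ?vs = (if ?c then ?t else Leaf False)"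
    unfolding verify_column_def a_def ..
  have run: "dt_run (verify n m j b) x = dt_run (if ?c then ?t else Leaf False) x"
    unfolding verify_def computes_run[OF col] col_eq ..
  have len: "length (map (\<lambda>i. (i, b)) [0..<n]) * 1 = n" "length [0..<m] = m" by simp_all
  have "dt_cost (verify n m j b) x \<le> n + dt_cost (if ?c then ?t else Leaf False) x"
    using computes_cost[OF col, of "verify_column n m j b"] unfolding verify_def col_eq len .
  moreover have "dt_cost ?t x \<le> m * Suc L"
    using computes_cost[OF paths] unfolding verify_special_def len by (rule order_trans) simp
  ultimately show "dt_cost (verify n m j b) x \<le> n + m * Suc L"
    by (auto split: if_splits)
  have r: "r j' = Some (l, x l)" if "follow x a (Tpath m j') = Some l" for j' l
    using that by (simp add: r_def)
  have a_iff: "certifies n m x j a \<longleftrightarrow> dt_run ?t x" if c: ?c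
  proof -
    have "fst a < n \<and> ?vs ! fst a \<noteq> blank"
      unfolding a_def fst_conv using c theI'[of "\<lambda>i. i < n \<and> ?vs ! i \<noteq> blank"] by blast
    moreover have "?vs ! fst a = x a" if "fst a < n"
    proof -
      have "(fst a, b) = a" using sa by (simp add: prod_eq_iff)
      then show ?thesis using that by simp
    qed
    ultimately have a: "a \<in> Mset n m" "snd a = b" "x a \<noteq> blank"
      using conjunct1[OF c] sa by (auto simp: mem_Times_iff Mset_def)
    have uniq: "a' = a" if "a' \<in> Mset n m" "snd a' = b" "x a' \<noteq> blank" for a'
    proof -
      have "fst a' < n" "?vs ! fst a' \<noteq> blank" using that by (auto simp: Mset_def)
      then have "fst a' = fst a" using c \<open>fst a < n \<and> ?vs ! fst a \<noteq> blank\<close> by blast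
      then show ?thesis using that a by (simp add: prod_eq_iff)
    qed
    have marked: "marked_col n x b" using conjunct1[OF conjunct2[OF c]] by (auto simp: marked_col_def)
    let ?leaf = "\<lambda>j'. \<exists>l. follow x a (Tpath m j') = Some l \<and> snd l = j' \<and> \<not> sval (x l)"
    have leaf: "is_leaf n j' (r j') \<longleftrightarrow> ?leaf j'" for j'
      using follow_in_Mset[OF x a(1), of "Tpath m j'"]
      by (fastforce simp: is_leaf_def r_def Mset_def)
    \<comment> \<open>The two back pointers agree only along a successful path, as
      \<open>the None\<close> is unspecified; they are therefore compared under the leaf
      condition.\<close>
    have bp: "bpoint (snd (the (r j'))) = bpoint (x (the (follow x a (Tpath m j'))))"
      if "?leaf j'" for j'
      using that r by auto
    have "dt_run ?t x \<longleftrightarrow> (\<forall>j'<m. j' \<noteq> b \<longrightarrow> ?leaf j') \<and>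
           card {j'. j' < m \<and> j' \<noteq> b \<and> bpoint (snd (the (r j'))) = Some a} = m div 2 \<and>
           j \<noteq> b \<and> bpoint (snd (the (r j))) = Some a"
      unfolding verify_special_def sa computes_run[OF paths] using j by (simp add: leaf cong: conj_cong)
    also have "\<dots> \<longleftrightarrow> (\<forall>j'<m. j' \<noteq> b \<longrightarrow> ?leaf j') \<and>
           card {j'. j' < m \<and> j' \<noteq> b \<and> bpoint (x (the (follow x a (Tpath m j')))) = Some a} = m div 2 \<and>
           j \<noteq> b \<and> bpoint (x (the (follow x a (Tpath m j)))) = Some a"
      using bp j by (auto cong: conj_cong)
    also have "\<dots> \<longleftrightarrow> certifies n m x j a"
      using a uniq marked unfolding certifies_def by blast
    finally show ?thesis ..
  qed
  \<comment> \<open>Conversely, a certified cell of column \<open>b\<close> makes the initial check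
    succeed and is the cell selected by \<open>THE\<close>.\<close>
  have c_if: "?c \<and> a' = a" if a': "certifies n m x j a'" "snd a' = b" for a'
  proof -
    have 1: "a' \<in> Mset n m" "x a' \<noteq> blank" "\<forall>i<n. sval (x (i, b))"
      "\<And>a''. a'' \<in> Mset n m \<Longrightarrow> snd a'' = b \<Longrightarrow> x a'' \<noteq> blank \<Longrightarrow> a'' = a'"
      using a' by (auto simp: certifies_def marked_col_def)
    have b: "b < m" and i: "fst a' < n" "a' = (fst a', b)"
      using 1(1) a'(2) by (auto simp: Mset_def)
    have *: "i < n \<and> ?vs ! i \<noteq> blank \<longleftrightarrow> i = fst a'" for i
    proof
      assume "i < n \<and> ?vs ! i \<noteq> blank"
      then have "(i, b) = a'" using b by (intro 1(4)) (auto simp: Mset_def)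
      then show "i = fst a'" by auto
    next
      assume "i = fst a'"
      then show "i < n \<and> ?vs ! i \<noteq> blank" using i 1(2) by simp
    qed
    then have "a = a'" using i by (simp add: a_def)
    moreover have ?c using b 1(3) unfolding * by simp
    ultimately show ?thesis by simp
  qed
  show "dt_run (verify n m j b) x \<longleftrightarrow> (\<exists>a. snd a = b \<and> certifies n m x j a)"
  proof (cases ?c)
    case True
    have "dt_run (verify n m j b) x \<longleftrightarrow> certifies n m x j a"
      unfolding run if_P[OF True] using a_iff[OF True] ..
    then show ?thesis using c_if sa by blast
  next
    case False
    have "\<not> dt_run (verify n m j b) x" unfolding run if_not_P[OF False] by simp
    then show ?thesis using c_if False by blast
  qed
qed

section \<open>Elimination of columns and candidates\<close>

text \<open>A successful probe into column \<open>j'\<close> shows that \<open>j'\<close> is not marked; a failed one shows that the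
  candidate is not special. So each probe removes a column or a candidate.\<close>

function eliminate :: "nat \<Rightarrow> nat \<Rightarrow> nat \<Rightarrow> cell list \<Rightarrow> nat list \<Rightarrow> dtree" where
  "eliminate n m j [] al = Leaf False"
| "eliminate n m j (a # cs) al = (case filter (\<lambda>j'. j' \<noteq> snd a) al of
      [] \<Rightarrow> verify n m j (snd a)
    | j' # _ \<Rightarrow> probe (Tpath m j') a (\<lambda>r.
        if is_leaf n j' r then eliminate n m j (a # cs) (removeAll j' al) else eliminate n m j cs al))"
  by pat_completeness auto
termination
proof (relation "Wellfounded.measure (\<lambda>(_, _, _, cs, al). length cs + length al)", goal_cases)
  case (2 n m j a cs al j' js)
  then have "j' \<in> set al" by (metis filter_is_subset list.set_intros(1) subsetD)
  then show ?case by (simp add: length_removeAll_less)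
qed auto

text \<open>Acceptance comes only from \<open>verify\<close>, which gives soundness for any lists;
  completeness is the invariant that a certified candidate and its column both survive. Each probe
  costs at most \<open>Suc L\<close> and shortens one list, and a single verification ends the
  run.\<close>

lemma eliminate_run_cost:
  assumes x: "x \<in> Inputs n m" and j: "j < m" and L: "\<And>j. j < m \<Longrightarrow> length (Tpath m j) \<le> L"
  shows "set al \<subseteq> {..<m} \<Longrightarrow>
     (dt_run (eliminate n m j cs al) x \<longrightarrow> (\<exists>a. certifies n m x j a)) \<and>
     (\<forall>a. certifies n m x j a \<and> a \<in> set cs \<and> snd a \<in> set al \<longrightarrow> dt_run (eliminate n m j cs al) x) \<and>
     dt_cost (eliminate n m j cs al) x \<le> (length cs + length al) * Suc L + (n + m * Suc L)"
proof (induction "length cs + length al" arbitrary: cs al rule: less_induct)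
  case less
  show ?case
  proof (cases cs)
    case (Cons a cs')
    show ?thesis
    proof (cases "filter (\<lambda>j'. j' \<noteq> snd a) al")
      case Nil
      \<comment> \<open>Any certified cell whose column survives now lies in column
        \<open>snd a\<close>, even if it differs from \<open>a\<close>.\<close>
      then have "\<And>j'. j' \<in> set al \<Longrightarrow> j' = snd a" by (simp add: filter_empty_conv)
      then show ?thesis
        using verify_run_cost[OF x j L, of "snd a"] Nil Cons by fastforce
    next
      case (Cons j' js)
      have "j' \<in> set (filter (\<lambda>j'. j' \<noteq> snd a) al)" by (simp add: Cons)
      then have al: "j' \<in> set al" and neq: "j' \<noteq> snd a" by auto
      then have j': "j' < m" using less.prems by auto
      define r where "r = map_option (\<lambda>l. (l, x l)) (follow x a (Tpath m j'))"
      define al' where "al' = removeAll j' al"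
      define t where "t = (if is_leaf n j' r then eliminate n m j cs al' else eliminate n m j cs' al)"
      note probe = computes_probe[OF L[OF j'], of x a, folded r_def]
      have eq: "eliminate n m j cs al = probe (Tpath m j') a (\<lambda>r.
          if is_leaf n j' r then eliminate n m j cs al' else eliminate n m j cs' al)"
        unfolding al'_def \<open>cs = a # cs'\<close> by (simp add: Cons)
      have run: "dt_run (eliminate n m j cs al) x = dt_run t x"
        and cost: "dt_cost (eliminate n m j cs al) x \<le> Suc L + dt_cost t x"
        unfolding eq t_def by (rule computes_run[OF probe], rule computes_cost[OF probe])
      have len: "length al' < length al"
        unfolding al'_def using al by (rule length_removeAll_less)
      show ?thesis
      proof (cases "is_leaf n j' r")
        case True
        then obtain l where l: "fst l < n" "snd l = j'" "\<not> sval (x l)"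
          by (auto simp: is_leaf_def r_def)
        have "snd a' \<noteq> j'" if "certifies n m x j a'" for a'
          using that l unfolding certifies_def marked_col_def by (metis prod.collapse)
        then have al': "snd a' \<in> set al'" if "certifies n m x j a'" "snd a' \<in> set al" for a'
          using that by (auto simp: al'_def)
        have t: "t = eliminate n m j cs al'" using True by (simp add: t_def)
        have "length cs + length al' < length cs + length al" "set al' \<subseteq> {..<m}"
          using len less.prems by (auto simp: al'_def)
        note IH = less.hyps[OF this, folded t]
        have "Suc L + (length cs + length al') * Suc L \<le> (length cs + length al) * Suc L"
          using len mult_le_mono1[of "Suc (length cs + length al')" "length cs + length al" "Suc L"] by simp
        then have "Suc L + dt_cost t x \<le> (length cs + length al) * Suc L + (n + m * Suc L)"
          using IH by linarith
        then have "dt_cost (eliminate n m j cs al) x \<le> (length cs + length al) * Suc L + (n + m * Suc L)"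
          using cost by linarith
        then show ?thesis unfolding run using IH al' by blast
      next
        case False
        have neq_a: "a' \<noteq> a" if a': "certifies n m x j a'" for a'
        proof
          assume "a' = a"
          then obtain l where "follow x a (Tpath m j') = Some l" "fst l < n" "snd l = j'" "\<not> sval (x l)"
            using certifies_leaf[OF x a' j'] neq by blast
          then have "is_leaf n j' r" by (simp add: is_leaf_def r_def)
          then show False using False by simp
        qed
        have t: "t = eliminate n m j cs' al" using False by (simp add: t_def)
        have cs: "length cs = Suc (length cs')" "set cs = insert a (set cs')" using \<open>cs = a # cs'\<close> by simp_all
        then have "length cs' + length al < length cs + length al" by simp
        note IH = less.hyps[OF this less.prems, folded t]
        have "Suc L + (length cs' + length al) * Suc L = (length cs + length al) * Suc L"
          by (simp add: cs)
        then have "dt_cost (eliminate n m j cs al) x \<le> (length cs + length al) * Suc L + (n + m * Suc L)"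
          using IH cost by linarith
        then show ?thesis unfolding run cs(2) using IH neq_a by blast
      qed
    qed
  qed simp
qed

definition column_tree :: "nat \<Rightarrow> nat \<Rightarrow> nat \<Rightarrow> dtree" where
  "column_tree n m j = query_all Query (map (\<lambda>i. (i, j)) [0..<n]) (\<lambda>vs.
     eliminate n m j (map the (filter (\<lambda>p. p \<noteq> None) (map bpoint vs))) [0..<m])"

text \<open>The leaf of a certified column lies in that column and points back to the special
  element, which is thus among the candidates. The cost consists of two column reads, at most
  \<open>n + m\<close> elimination probes and \<open>m\<close> verification probes.\<close>

lemma column_tree_run_cost:
  assumes x: "x \<in> Inputs n m" and j: "j < m" and L: "\<And>j. j < m \<Longrightarrow> length (Tpath m j) \<le> L"
  shows "dt_run (column_tree n m j) x \<longleftrightarrow> (\<exists>a. certifies n m x j a)"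
    and "dt_cost (column_tree n m j) x \<le> 2 * n + (n + 2 * m) * Suc L"
proof -
  let ?vs = "map x (map (\<lambda>i. (i, j)) [0..<n])"
  let ?cs = "map the (filter (\<lambda>p. p \<noteq> None) (map bpoint ?vs))"
  have col: "computes x (query_all Query (map (\<lambda>i. (i, j)) [0..<n])) ?vs (length (map (\<lambda>i. (i, j)) [0..<n]) * 1)"
    by (intro computes_query_all computes_Query)
  have run: "dt_run (column_tree n m j) x = dt_run (eliminate n m j ?cs [0..<m]) x"
    unfolding column_tree_def by (rule computes_run[OF col])
  have cost: "dt_cost (column_tree n m j) x \<le> n + dt_cost (eliminate n m j ?cs [0..<m]) x"
    using computes_cost[OF col, of "\<lambda>vs. eliminate n m j (map the (filter (\<lambda>p. p \<noteq> None) (map bpoint vs))) [0..<m]"]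
    unfolding column_tree_def length_map length_upt by simp
  have "set [0..<m] \<subseteq> {..<m}" by auto
  note elim = eliminate_run_cost[OF x j L this, of ?cs]
  have cand: "a \<in> set ?cs \<and> snd a \<in> set [0..<m]" if a: "certifies n m x j a" for a
  proof -
    have "j \<noteq> snd a" and bp: "bpoint (x (the (follow x a (Tpath m j)))) = Some a"
      using a by (auto simp: certifies_def)
    then obtain l where l: "follow x a (Tpath m j) = Some l" "fst l < n" "snd l = j"
      using certifies_leaf[OF x a j] by blast
    have "x (fst l, j) \<in> set ?vs" "bpoint (x (fst l, j)) = Some a" using l bp by auto
    then have "Some a \<in> set (filter (\<lambda>p. p \<noteq> None) (map bpoint ?vs))"
      unfolding set_filter set_map by (metis (mono_tags, lifting) imageI mem_Collect_eq option.distinct(1))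
    then have "a \<in> set ?cs" unfolding set_map by (metis image_eqI option.sel)
    then show ?thesis using a by (auto simp: certifies_def Mset_def)
  qed
  then show "dt_run (column_tree n m j) x \<longleftrightarrow> (\<exists>a. certifies n m x j a)"
    unfolding run using elim by blast
  have "length ?cs \<le> n"
    using length_filter_le[of "\<lambda>p. p \<noteq> None" "map bpoint ?vs"] by simp
  then have "(length ?cs + length [0..<m]) * Suc L \<le> (n + m) * Suc L"
    by (intro mult_le_mono1) simp
  then have "dt_cost (column_tree n m j) x \<le> n + ((n + m) * Suc L + (n + m * Suc L))"
    using cost elim by linarith
  also have "\<dots> = 2 * n + (n + 2 * m) * Suc L" by (simp add: algebra_simps)
  finally show "dt_cost (column_tree n m j) x \<le> 2 * n + (n + 2 * m) * Suc L" .
qed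

section \<open>Logarithmic length of the paths\<close>

lemma tree_depth_le_log:
  assumes "0 < m"
  shows "real (tree_depth m) \<le> log 2 (real m)"
proof -
  have "2 ^ tree_depth m \<le> m"
    unfolding tree_depth_def
  \<comment> \<open>\<open>GREATEST\<close> needs a qualifying exponent and a bound: 0 qualifies,
    and \<open>k < 2 ^ k\<close> bounds all others by \<open>m\<close>.\<close>
  proof (rule GreatestI_nat)
    show "2 ^ 0 \<le> m" using assms by simp
    show "k \<le> m" if "2 ^ k \<le> m" for k
      using that less_exp[of k] by linarith
  qed
  then have "real (2 ^ tree_depth m) \<le> real m" by (simp only: of_nat_le_iff)
  then show ?thesis using assms by (simp add: le_log_iff powr_realpow)
qed

lemma length_bin_digits [simp]: "length (bin_digits k t) = k"
  by (induction k arbitrary: t) auto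

lemma length_Tpath: "length (Tpath m j) \<le> Suc (tree_depth m)"
  by (simp add: Tpath_def Let_def)

section \<open>Query complexity bounds\<close>

text \<open>By \<open>card_certified\<close> the fraction of accepting columns is exactly 1/2 or 0;
  the cost bound holds for every tree in the support, hence in expectation.\<close>

lemma R1_le:
  assumes m: "0 < m" "even m" and d: "\<And>x j. x \<in> Inputs n m \<Longrightarrow> j < m \<Longrightarrow> dt_cost (column_tree n m j) x \<le> d"
    and run: "\<And>x j. x \<in> Inputs n m \<Longrightarrow> j < m \<Longrightarrow>
      dt_run (column_tree n m j) x \<longleftrightarrow> (\<exists>a. certifies n m x j a)"
  shows "R1 (Inputs n m) (g_fun n m) \<le> ennreal (real d)"
proof -
  define D where "D = map_pmf (column_tree n m) (pmf_of_set {..<m})"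
  have ne: "{..<m} \<noteq> {}" using m by auto
  have "measure_pmf.prob D {t. dt_run t x} = (if g_fun n m x then 1 / 2 else 0)" if x: "x \<in> Inputs n m" for x
  proof -
    have "measure_pmf.prob D {t. dt_run t x} =
        real (card ({..<m} \<inter> {j. dt_run (column_tree n m j) x})) / real m"
      using ne by (simp add: D_def measure_pmf_of_set vimage_def)
    also have "{..<m} \<inter> {j. dt_run (column_tree n m j) x} = {j. j < m \<and> (\<exists>a. certifies n m x j a)}"
      using run[OF x] by auto
    also have "real (card \<dots>) / real m = (if g_fun n m x then 1 / 2 else 0)"
      unfolding card_certified[OF x] using m by (simp add: real_of_nat_div)
    finally show ?thesis .
  qed
  then have "one_sided (Inputs n m) (g_fun n m) D" by (simp add: one_sided_def)
  then have "R1 (Inputs n m) (g_fun n m) \<le> worst_expected_cost (Inputs n m) D"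
    unfolding R1_def by (intro INF_lower) simp
  also have "\<dots> \<le> ennreal (real d)"
    unfolding worst_expected_cost_def
  proof (rule SUP_least)
    fix x assume x: "x \<in> Inputs n m"
    have "(\<integral>\<^sup>+ t. ennreal (real (dt_cost t x)) \<partial>measure_pmf D) \<le> (\<integral>\<^sup>+ t. ennreal (real d) \<partial>measure_pmf D)"
      using ne d[OF x] by (intro nn_integral_mono_AE) (auto simp: AE_measure_pmf_iff D_def)
    then show "(\<integral>\<^sup>+ t. ennreal (real (dt_cost t x)) \<partial>measure_pmf D) \<le> ennreal (real d)"
      by simp
  qed
  finally show ?thesis .
qed

text \<open>\<open>next_query\<close> and \<open>verdict\<close> turn the column trees into
  strategies padded to exactly \<open>d\<close> queries, so all branches run in lockstep; computing
  and clearing the answers doubles the count.\<close>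

lemma QE_le:
  assumes n: "0 < n" and m: "0 < m" "even m" and d0: "0 < d"
    and d: "\<And>x j. x \<in> Inputs n m \<Longrightarrow> j < m \<Longrightarrow> dt_cost (column_tree n m j) x \<le> d"
    and run: "\<And>x j. x \<in> Inputs n m \<Longrightarrow> j < m \<Longrightarrow>
      dt_run (column_tree n m j) x \<longleftrightarrow> (\<exists>a. certifies n m x j a)"
  shows "QE n m (Inputs n m) (g_fun n m) \<le> 2 * d"
proof -
  obtain d' where d': "d = Suc d'" using d0 by (cases d) auto
  define u where "u j = next_query n m (column_tree n m j)" for j
  \<comment> \<open>The row-major index that \<open>cell_of\<close> inverts.\<close>
  define nx where "nx j h = fst (u j h) * m + snd (u j h)" for j h
  have u: "fst (u j h) < n" "snd (u j h) < m" for j h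
    using next_query_in_Mset[OF n m(1), of "column_tree n m j" h] by (auto simp: u_def Mset_def)
  have cell: "cell_of m (nx j h) = u j h" for j h
    using u(2)[of j h] by (simp add: cell_of_def nx_def)
  have "exact_quantum n m (Inputs n m) (g_fun n m) (2 * Suc d')"
  proof (rule exact_quantum_balanced[where nx = nx and out = "\<lambda>j. verdict n m (column_tree n m j)"])
    show "2 \<le> m" "even m" using m by presburger+
    show "nx j h < n * m" for j h
      unfolding nx_def using u by (rule mixed_radix_less)
    show "sym_enc n m (x (cell_of m c)) < Ssize n m" if "x \<in> Inputs n m" "c < n * m" for x c
    proof (rule sym_enc_less)
      have "cell_of m c \<in> Mset n m"
        using that(2) m by (simp add: cell_of_def Mset_def less_mult_imp_div_less)
      then show "x (cell_of m c) \<in> Sigma_alph n m" using that(1) by (auto simp: Inputs_def PiE_iff)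
    qed
    show "card {j. j < m \<and> verdict n m (column_tree n m j)
        (history (\<lambda>h. sym_enc n m (x (cell_of m (nx j h)))) (Suc d'))} =
      (if g_fun n m x then m div 2 else 0)" if x: "x \<in> Inputs n m" for x
    proof -
      have "verdict n m (column_tree n m j)
        (history (\<lambda>h. sym_enc n m (x (cell_of m (nx j h)))) (Suc d')) \<longleftrightarrow> (\<exists>a. certifies n m x j a)"
        if "j < m" for j
        unfolding cell u_def using verdict_history[OF x d[OF x that]] run[OF x that] by (simp only: d')
      then show ?thesis
        unfolding card_certified[OF x, symmetric] by (intro arg_cong[where f = card] Collect_cong) blast
    qed
  qed
  then show ?thesis unfolding QE_def d' by (intro cInf_lower) auto
qed

theorem theorem12:
  "\<exists>C k :: real. \<forall>n m :: nat. n > 0 \<longrightarrow> m > 0 \<longrightarrow> even m \<longrightarrow>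
      R1 (Inputs n m) (g_fun n m)
        \<le> ennreal (C * real (n + m) * (1 + log 2 (real (n + m))) powr k) \<and>
      real (QE n m (Inputs n m) (g_fun n m))
        \<le> C * real (n + m) * (1 + log 2 (real (n + m))) powr k"
proof (rule exI[of _ 12], rule exI[of _ 1], intro allI impI)
  fix n m :: nat assume n: "0 < n" and m: "0 < m" "even m"
  define lam where "lam = 1 + log 2 (real (n + m))"
  define L where "L = Suc (tree_depth m)"
  define d where "d = 2 * n + (n + 2 * m) * Suc L"
  have L: "length (Tpath m j) \<le> L" for j by (simp add: L_def length_Tpath)
  note tree = column_tree_run_cost[where n = n, OF _ _ L, folded d_def]
  have "0 < d" using n by (simp add: d_def)
  have lam: "1 \<le> lam" using n m by (simp add: lam_def)
  have "log 2 (real m) \<le> log 2 (real (n + m))" using m by simp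
  \<comment> \<open>\<open>Suc L\<close> is \<open>tree_depth m + 2\<close>, hence at most
    \<open>lam + 1\<close>, and \<open>lam\<close> is at least 1.\<close>
  then have "real (Suc L) \<le> 2 * lam"
    using tree_depth_le_log[OF m(1)] lam by (simp add: L_def lam_def)
  then have "real (n + 2 * m) * real (Suc L) \<le> (2 * real (n + m)) * (2 * lam)"
    by (intro mult_mono) auto
  moreover have "2 * real n * 1 \<le> 2 * real (n + m) * lam"
    using lam by (intro mult_mono) auto
  moreover have "real d = 2 * real n * 1 + real (n + 2 * m) * real (Suc L)"
    by (simp only: d_def of_nat_add of_nat_mult of_nat_numeral mult_1_right)
  \<comment> \<open>The paths contribute 4 and the two column reads 2; the quantum bound
    \<open>2 * d\<close> then gives the constant 12.\<close>
  ultimately have d: "real d \<le> 6 * real (n + m) * lam" by linarith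
  have "R1 (Inputs n m) (g_fun n m) \<le> ennreal (real d)"
    using m tree(2) tree(1) by (rule R1_le)
  also have "\<dots> \<le> ennreal (12 * real (n + m) * lam)"
    using d by (intro ennreal_leI) linarith
  finally have R: "R1 (Inputs n m) (g_fun n m) \<le> ennreal (12 * real (n + m) * lam)" .
  have "QE n m (Inputs n m) (g_fun n m) \<le> 2 * d"
    using n m \<open>0 < d\<close> tree(2) tree(1) by (rule QE_le)
  then have "real (QE n m (Inputs n m) (g_fun n m)) \<le> 12 * real (n + m) * lam"
    using d by linarith
  then show "R1 (Inputs n m) (g_fun n m)
        \<le> ennreal (12 * real (n + m) * (1 + log 2 (real (n + m))) powr 1) \<and>
      real (QE n m (Inputs n m) (g_fun n m))
        \<le> 12 * real (n + m) * (1 + log 2 (real (n + m))) powr 1"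
    using R lam by (simp add: lam_def)
qed

end
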